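(* Given an initial value $(x(0),v(0))\in\mathbb{R}^n\times\mathbb{R}^m$ with $x(0)\in K$, the trajectory $(x(t),v(t))$, $t\ge 0$, of the projected dynamical system $$\dot{x}=\Pi_K\big(x,-\nabla f(x)-A^Tv-A^T(Ax-b)\big),\qquad \dot{v}=Ax-b,$$ asymptotically converges (as $t\to\infty$) to one of the saddle points of the problem $\min\{f(x): x\in K,\ Ax-b=0\}$, i.e. to a saddle point of its Lagrangian $\mathscr{L}(x,v)=f(x)+v^T(Ax-b)$ on $K\times\mathbb{R}^m$.
   Context: Setting: $K\subset\mathbb{R}^n$ is a closed convex set (such that calculating the projection on its tangent cone is computationally cheap), $A\in\mathbb{R}^{m\times n}$, $b\in\mathbb{R}^m$, and $f:\mathbb{R}^n\to\mathbb{R}$ is a differentiable convex function, not necessarily strictly convex, whose gradient is locally Lipschitz continuous. Slater's condition is assumed to hold for the problem $\min\{f(x): x\in K,\ Ax-b=0\}$, and hence strong duality holds. Lagrangian: $\mathscr{L}:K\times\mathbb{R}^m\to\mathbb{R}$, $\mathscr{L}(x,v)=f(x)+v^T(Ax-b)$. A pair $(x^*,v^* )\in K\times\mathbb{R}^m$ is a saddle point if $\mathscr{L}(x^*,v)\le\mathscr{L}(x^*,v^* )\le\mathscr{L}(x,v^* )$ for all $x\in K$, $v\in\mathbb{R}^m$; under strong duality this holds if and only if $x^*$ is an optimal solution of the problem and $v^*$ is an optimal solution of its dual problem. Projection operator: $P_K(x)=\arg\min_{y\in K}\|x-y\|$ (Euclidean norm), and for $x\in K$, $u\in\mathbb{R}^n$,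 $\Pi_K(x,u)=\lim_{\delta\to 0^+}\frac{P_K(x+\delta u)-x}{\delta}=P_{T_K(x)}(u)$, where $T_K(x)$ is the tangent cone of $K$ at $x$. The trajectory is the unique Carathéodory solution of the system with the given initial value: an absolutely continuous curve with $x(t)\in K$ that satisfies the differential equations for almost every $t\ge 0$.
   Formalization: It is additionally assumed that the problem min{f(x): x in K, Ax-b=0} has an optimal solution; without this the claim is false (K=R, A=0, b=0, f(x)=exp(-x) has no saddle point and its trajectory diverges). *)

theory Defs
  imports "HOL-Analysis.Analysis"
begin

text \<open>
  The operator \<open>\<Pi>\<^sub>K(x,u)\<close>, as the one-sided directional derivative at \<open>x\<close> of the metric
  projection \<open>P\<^sub>K\<close> (the library's \<^const>\<open>closest_point\<close>). For \<open>K\<close> closed and convex and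
  \<open>x \<in> K\<close>, the only case in which it is used, \<^const>\<open>closest_point\<close> is the unique minimiser
  of the distance and the limit exists.
\<close>

definition proj_operator :: "'a::euclidean_space set \<Rightarrow> 'a \<Rightarrow> 'a \<Rightarrow> 'a" where
  "proj_operator K x u =
     Lim (at_right 0) (\<lambda>\<delta>::real. (closest_point K (x + \<delta> *\<^sub>R u) - x) /\<^sub>R \<delta>)"

definition lagrangian ::
    "(real^'n \<Rightarrow> real) \<Rightarrow> real^'n^'m \<Rightarrow> real^'m \<Rightarrow> real^'n \<Rightarrow> real^'m \<Rightarrow> real" where
  "lagrangian f A b x v = f x + v \<bullet> (A *v x - b)"

definition saddle_point ::
    "(real^'n) set \<Rightarrow> (real^'n \<Rightarrow> real) \<Rightarrow> real^'n^'m \<Rightarrow> real^'m \<Rightarrow> real^'n \<Rightarrow> real^'m \<Rightarrow> bool" where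
  "saddle_point K f A b xs vs \<longleftrightarrow>
     xs \<in> K \<and>
     (\<forall>x\<in>K. \<forall>v. lagrangian f A b xs v \<le> lagrangian f A b xs vs \<and>
               lagrangian f A b xs vs \<le> lagrangian f A b x vs)"

definition optimal_solution ::
    "(real^'n) set \<Rightarrow> (real^'n \<Rightarrow> real) \<Rightarrow> real^'n^'m \<Rightarrow> real^'m \<Rightarrow> real^'n \<Rightarrow> bool" where
  "optimal_solution K f A b xs \<longleftrightarrow>
     xs \<in> K \<and> A *v xs = b \<and> (\<forall>x\<in>K. A *v x = b \<longrightarrow> f xs \<le> f x)"

text \<open>
  As \<open>f\<close> is finite everywhere and the equality constraint is affine, Slater's condition only asks
  for a feasible point in the relative interior of \<open>K\<close>. It does not imply that the minimum is attained.
\<close>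

definition slater_condition :: "(real^'n) set \<Rightarrow> real^'n^'m \<Rightarrow> real^'m \<Rightarrow> bool" where
  "slater_condition K A b \<longleftrightarrow> (\<exists>x\<in>rel_interior K. A *v x = b)"

text \<open>
  The usual \<open>\<epsilon>\<close>-\<open>\<delta>\<close> definition of absolute continuity of a curve: \<open>D\<close> ranges over the finite
  families of compact subintervals \<open>{Inf k..Sup k}\<close> of \<open>S\<close> with pairwise disjoint interiors.
\<close>

definition abs_continuous_on :: "real set \<Rightarrow> (real \<Rightarrow> 'a::real_normed_vector) \<Rightarrow> bool" where
  "abs_continuous_on S g \<longleftrightarrow>
     (\<forall>\<epsilon>>0. \<exists>\<delta>>0. \<forall>D. D division_of \<Union>D \<and> \<Union>D \<subseteq> S \<and> (\<Sum>k\<in>D. Sup k - Inf k) < \<delta> \<longrightarrow>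
        (\<Sum>k\<in>D. norm (g (Sup k) - g (Inf k))) < \<epsilon>)"

end

theory Submission
  imports Defs
begin

text \<open>
  Slater's condition yields a saddle point \<open>(xs, vs)\<close>. Half the squared distance of the trajectory to
  any saddle point decreases at a rate of at least
  \<open>gap (x t) = f (x t) + vs \<bullet> (A x t - b) - f xs + \<parallel>A x t - b\<parallel>\<^sup>2 \<ge> 0\<close>, because
  \<open>u - \<Pi>\<^sub>K(x,u)\<close> is normal to \<open>K\<close> at \<open>x\<close>. So the trajectory is bounded, \<open>x\<close> is Lipschitz, and a Barbalat
  argument gives \<open>gap (x t) \<longlongrightarrow> 0\<close>; limit points of \<open>x\<close> are therefore primal optimal. Since \<open>v\<close> has
  velocity \<open>A x - b \<longlongrightarrow> 0\<close>, following the distance of \<open>x\<close> to an arbitrary \<open>y \<in> K\<close> over long windows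
  shows that limit points of \<open>(x, v)\<close> are saddle points. As the distance to such a limit point is
  nonincreasing, the whole trajectory converges to it.
\<close>

subsection \<open>Absolutely continuous curves\<close>

lemma abs_continuous_onE:
  assumes "abs_continuous_on S g" "\<epsilon> > 0"
  obtains \<delta> where "\<delta> > 0" "\<And>D. D division_of \<Union>D \<and> \<Union>D \<subseteq> S \<and> (\<Sum>k\<in>D. Sup k - Inf k) < \<delta>
        \<Longrightarrow> (\<Sum>k\<in>D. norm (g (Sup k) - g (Inf k))) < \<epsilon>"
  using assms unfolding abs_continuous_on_def by meson

lemma abs_continuous_on_subset:
  "abs_continuous_on S g \<Longrightarrow> T \<subseteq> S \<Longrightarrow> abs_continuous_on T g"
  unfolding abs_continuous_on_def by (meson order_trans)

text \<open>This passes from a curve to scalar functions of it, such as its squared distance to a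
  point or its inner product with a vector.\<close>

lemma abs_continuous_on_dominated:
  fixes g :: "real \<Rightarrow> 'a::real_normed_vector" and h :: "real \<Rightarrow> 'b::real_normed_vector"
  assumes ac: "abs_continuous_on S g"
    and le: "\<And>s t. s \<in> S \<Longrightarrow> t \<in> S \<Longrightarrow> norm (h t - h s) \<le> C * norm (g t - g s)"
  shows "abs_continuous_on S h"
  unfolding abs_continuous_on_def
proof (intro allI impI)
  fix \<epsilon> :: real assume "\<epsilon> > 0"
  \<comment> \<open>The tolerance is divided by the constant, and \<open>C\<close> may be zero or
    negative.\<close>
  define B where "B = max C 1"
  have B: "B > 0" "C \<le> B" by (auto simp: B_def)
  obtain \<delta> where \<delta>: "\<delta> > 0" "\<And>D. D division_of \<Union>D \<and> \<Union>D \<subseteq> S \<and> (\<Sum>k\<in>D. Sup k - Inf k) < \<delta>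
        \<Longrightarrow> (\<Sum>k\<in>D. norm (g (Sup k) - g (Inf k))) < \<epsilon> / B"
    by (rule abs_continuous_onE[OF ac, of "\<epsilon> / B"]) (use \<open>\<epsilon> > 0\<close> B(1) in simp, rule that)
  have "(\<Sum>k\<in>D. norm (h (Sup k) - h (Inf k))) < \<epsilon>"
    if D: "D division_of \<Union>D \<and> \<Union>D \<subseteq> S \<and> (\<Sum>k\<in>D. Sup k - Inf k) < \<delta>" for D
  proof -
    have "norm (h (Sup k) - h (Inf k)) \<le> B * norm (g (Sup k) - g (Inf k))" if k: "k \<in> D" for k
    proof -
      obtain a b where ab: "k = cbox a b" "k \<noteq> {}" "k \<subseteq> S"
        using D k division_ofD(3,4)[of D "\<Union>D"] by (metis Sup_upper order_trans)
      then have "Sup k \<in> S" "Inf k \<in> S" by auto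
      then have "norm (h (Sup k) - h (Inf k)) \<le> C * norm (g (Sup k) - g (Inf k))"
        using le by blast
      also have "\<dots> \<le> B * norm (g (Sup k) - g (Inf k))"
        using B by (intro mult_right_mono) auto
      finally show ?thesis .
    qed
    then have "(\<Sum>k\<in>D. norm (h (Sup k) - h (Inf k))) \<le> B * (\<Sum>k\<in>D. norm (g (Sup k) - g (Inf k)))"
      unfolding sum_distrib_left by (rule sum_mono)
    also have "\<dots> < \<epsilon>"
      using \<delta>(2)[OF D] B by (simp add: field_simps)
    finally show ?thesis .
  qed
  with \<delta>(1) show "\<exists>\<delta>>0. \<forall>D. D division_of \<Union>D \<and> \<Union>D \<subseteq> S \<and> (\<Sum>k\<in>D. Sup k - Inf k) < \<delta> \<longrightarrow>
        (\<Sum>k\<in>D. norm (h (Sup k) - h (Inf k))) < \<epsilon>" by blast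
qed

lemma abs_continuous_on_Pair:
  assumes g: "abs_continuous_on S g" and h: "abs_continuous_on S h"
  shows "abs_continuous_on S (\<lambda>t. (g t, h t))"
  unfolding abs_continuous_on_def
proof (intro allI impI)
  fix \<epsilon> :: real assume "\<epsilon> > 0"
  then have e: "\<epsilon> / 2 > 0" by simp
  obtain \<delta>1 where \<delta>1: "\<delta>1 > 0" "\<And>D. D division_of \<Union>D \<and> \<Union>D \<subseteq> S \<and> (\<Sum>k\<in>D. Sup k - Inf k) < \<delta>1
        \<Longrightarrow> (\<Sum>k\<in>D. norm (g (Sup k) - g (Inf k))) < \<epsilon> / 2"
    by (rule abs_continuous_onE[OF g e]) (rule that)
  obtain \<delta>2 where \<delta>2: "\<delta>2 > 0" "\<And>D. D division_of \<Union>D \<and> \<Union>D \<subseteq> S \<and> (\<Sum>k\<in>D. Sup k - Inf k) < \<delta>2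
        \<Longrightarrow> (\<Sum>k\<in>D. norm (h (Sup k) - h (Inf k))) < \<epsilon> / 2"
    by (rule abs_continuous_onE[OF h e]) (rule that)
  have "(\<Sum>k\<in>D. norm ((g (Sup k), h (Sup k)) - (g (Inf k), h (Inf k)))) < \<epsilon>"
    if D: "D division_of \<Union>D \<and> \<Union>D \<subseteq> S \<and> (\<Sum>k\<in>D. Sup k - Inf k) < min \<delta>1 \<delta>2" for D
  proof -
    have "(\<Sum>k\<in>D. norm ((g (Sup k), h (Sup k)) - (g (Inf k), h (Inf k))))
       \<le> (\<Sum>k\<in>D. norm (g (Sup k) - g (Inf k)) + norm (h (Sup k) - h (Inf k)))"
      by (intro sum_mono) (simp add: norm_Pair_le)
    also have "\<dots> < \<epsilon>"
      unfolding sum.distrib using \<delta>1(2)[of D] \<delta>2(2)[of D] D by simp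
    finally show ?thesis .
  qed
  then show "\<exists>\<delta>>0. \<forall>D. D division_of \<Union>D \<and> \<Union>D \<subseteq> S \<and> (\<Sum>k\<in>D. Sup k - Inf k) < \<delta> \<longrightarrow>
        (\<Sum>k\<in>D. norm ((g (Sup k), h (Sup k)) - (g (Inf k), h (Inf k)))) < \<epsilon>"
    using \<delta>1(1) \<delta>2(1) by (intro exI[of _ "min \<delta>1 \<delta>2"]) auto
qed

text \<open>A division consisting of a single short interval already gives the estimate.\<close>

lemma abs_continuous_on_imp_continuous_on:
  assumes "abs_continuous_on {a..b} g"
  shows "continuous_on {a..b} g"
  unfolding continuous_on_iff
proof (intro ballI allI impI)
  fix t \<epsilon> :: real assume t: "t \<in> {a..b}" and "\<epsilon> > 0"
  obtain \<delta> where \<delta>: "\<delta> > 0" "\<And>D. D division_of \<Union>D \<and> \<Union>D \<subseteq> {a..b} \<and> (\<Sum>k\<in>D. Sup k - Inf k) < \<delta>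
        \<Longrightarrow> (\<Sum>k\<in>D. norm (g (Sup k) - g (Inf k))) < \<epsilon>"
    by (rule abs_continuous_onE[OF assms \<open>\<epsilon> > 0\<close>]) (rule that)
  have *: "norm (g r - g s) < \<epsilon>" if "s \<le> r" "a \<le> s" "r \<le> b" "r - s < \<delta>" for r s
    using \<delta>(2)[of "{{s..r}}"] that division_of_self[of s r] by auto
  have "dist (g s) (g t) < \<epsilon>" if "s \<in> {a..b}" "dist s t < \<delta>" for s
    using *[of s t] *[of t s] that t
    by (cases "s \<le> t") (auto simp: dist_norm norm_minus_commute)
  with \<delta>(1) show "\<exists>d>0. \<forall>x'\<in>{a..b}. dist x' t < d \<longrightarrow> dist (g x') (g t) < \<epsilon>" by blast
qed

text \<open>Outer regularity makes \<open>U - N\<close> small, and putting the null set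
  \<open>N\<close> back leaves the measure unchanged.\<close>

lemma negligible_outer_open_measure:
  fixes N :: "real set"
  assumes "negligible N" "e > 0"
  obtains U where "open U" "N \<subseteq> U" "U \<in> lmeasurable" "measure lebesgue U < e"
proof -
  have N: "N \<in> null_sets lebesgue" using assms(1) negligible_iff_null_sets by blast
  obtain U where U: "open U" "N \<subseteq> U" "U - N \<in> lmeasurable" "emeasure lebesgue (U - N) < ennreal e"
    using sets_lebesgue_outer_open[of N e] N assms(2) by blast
  have eq: "U = (U - N) \<union> N" using U by blast
  have em: "emeasure lebesgue U = emeasure lebesgue (U - N)"
    using emeasure_Un_null_set[of "U - N" lebesgue N] U N eq by auto
  have Um: "U \<in> lmeasurable"
    using U(1,4) em by (intro fmeasurableI) (auto intro: less_trans)
  moreover have "measure lebesgue U < e"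
    using em U(4) assms(2) Um by (metis emeasure_eq_measure2 ennreal_less_iff measure_nonneg)
  ultimately show ?thesis using U that by blast
qed

text \<open>
  A Cousin-type argument: on a tagged division that is fine for a suitable gauge, the pieces tagged
  outside the exceptional set are controlled by the derivative, and those tagged inside it lie in an
  open set of small measure, where absolute continuity applies.
\<close>

lemma abs_continuous_on_increment_le:
  fixes g :: "real \<Rightarrow> real"
  assumes ac: "abs_continuous_on {a..b} g" and "a \<le> b" and N: "negligible N"
    and der: "\<And>t. t \<in> {a..b} - N \<Longrightarrow> \<exists>d\<le>c. (g has_real_derivative d) (at t within {a..b})"
  shows "g b - g a \<le> c * (b - a)"
proof (rule field_le_epsilon)
  fix e0 :: real assume "e0 > 0"
  \<comment> \<open>Error budget: the slack \<open>e\<close> in the slope costs at most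
    \<open>e0 / 2\<close>, the increments over the pieces tagged in \<open>N\<close> cost
    \<open>e0 / 4\<close>, and their missing length costs \<open>e0 / 4\<close>. The
    \<open>+ 1\<close> covers \<open>a = b\<close>.\<close>
  define e where "e = e0 / (2 * (b - a + 1))"
  have "e > 0" using \<open>e0 > 0\<close> \<open>a \<le> b\<close> by (simp add: e_def)
  have e_bound: "e * (b - a) \<le> e0 / 2"
    using \<open>e0 > 0\<close> \<open>a \<le> b\<close> by (simp add: e_def divide_simps)
  define C where "C = \<bar>c\<bar> + 1"
  have "C > 0" by (simp add: C_def)
  obtain \<delta> where \<delta>: "\<delta> > 0" "\<And>D. D division_of \<Union>D \<and> \<Union>D \<subseteq> {a..b} \<and> (\<Sum>k\<in>D. Sup k - Inf k) < \<delta>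
        \<Longrightarrow> (\<Sum>k\<in>D. norm (g (Sup k) - g (Inf k))) < e0 / 4"
    by (rule abs_continuous_onE[OF ac, of "e0 / 4"]) (use \<open>e0 > 0\<close> in simp, rule that)
  \<comment> \<open>The total length of the pieces tagged in \<open>N\<close> must be below
    \<open>\<delta>\<close> for absolute continuity, and below \<open>e0 / (4 * C)\<close> so that
    omitting it from the slope estimate stays cheap when \<open>c\<close> is negative.\<close>
  define \<mu> where "\<mu> = min \<delta> (e0 / (4 * C))"
  have "\<mu> > 0" using \<delta>(1) \<open>e0 > 0\<close> \<open>C > 0\<close> by (simp add: \<mu>_def)
  obtain U where U: "open U" "N \<subseteq> U" "U \<in> lmeasurable" "measure lebesgue U < \<mu>"
    using negligible_outer_open_measure[OF N \<open>\<mu> > 0\<close>] .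
  \<comment> \<open>Subtracting the first-order expansions at both ends bounds the increment only
    over intervals that contain the tag \<open>t\<close>.\<close>
  have "\<exists>r>0. (t \<in> N \<longrightarrow> ball t r \<subseteq> U) \<and> (t \<in> {a..b} - N \<longrightarrow>
      (\<forall>s\<in>{a..b} \<inter> ball t r. \<forall>s'\<in>{a..b} \<inter> ball t r. s \<le> t \<longrightarrow> t \<le> s' \<longrightarrow>
         g s' - g s \<le> (c + e) * (s' - s)))" for t
  proof (cases "t \<in> N")
    case True
    then show ?thesis using U openE by (metis DiffD2 subset_eq)
  next
    case tN: False
    show ?thesis
    proof (cases "t \<in> {a..b}")
      case True
      then obtain d where d: "d \<le> c" "(g has_real_derivative d) (at t within {a..b})"
        using der tN by blast
      then obtain r where r: "r > 0" and
        r2: "\<forall>y\<in>{a..b}. norm (y - t) < r \<longrightarrow> norm (g y - g t - d * (y - t)) \<le> e * norm (y - t)"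
        using \<open>e > 0\<close> unfolding has_field_derivative_def has_derivative_within_alt by blast
      have "g s' - g s \<le> (c + e) * (s' - s)"
        if s: "s \<in> {a..b} \<inter> ball t r" "s' \<in> {a..b} \<inter> ball t r" "s \<le> t" "t \<le> s'" for s s'
      proof -
        have "\<bar>g s' - g t - d * (s' - t)\<bar> \<le> e * (s' - t)"
          using r2[rule_format, of s'] s by (auto simp: dist_real_def)
        moreover have "\<bar>g s - g t - d * (s - t)\<bar> \<le> e * (t - s)"
          using r2[rule_format, of s] s by (auto simp: dist_real_def)
        moreover have "d * (s' - s) \<le> c * (s' - s)"
          using d(1) s by (intro mult_right_mono) auto
        ultimately show ?thesis by (simp add: algebra_simps abs_le_iff)
      qed
      then show ?thesis using r tN by blast
    next
      case False
      then show ?thesis using tN zero_less_one by blast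
    qed
  qed
  then obtain r where r: "\<And>t. r t > 0" and rN: "\<And>t. t \<in> N \<Longrightarrow> ball t (r t) \<subseteq> U"
    and rd: "\<And>t s s'. t \<in> {a..b} - N \<Longrightarrow> s \<in> {a..b} \<inter> ball t (r t) \<Longrightarrow>
         s' \<in> {a..b} \<inter> ball t (r t) \<Longrightarrow> s \<le> t \<Longrightarrow> t \<le> s' \<Longrightarrow> g s' - g s \<le> (c + e) * (s' - s)"
    by metis
  have "gauge (\<lambda>t. ball t (r t))" using r by (simp add: gauge_def)
  then obtain p where p: "p tagged_division_of {a..b}" "(\<lambda>t. ball t (r t)) fine p"
    using fine_division_exists_real by blast
  define q where "q = {z \<in> p. fst z \<in> N}"
  have finp: "finite p" using p by blast
  have K: "\<exists>u v. K = {u..v} \<and> u \<le> t \<and> t \<le> v \<and> a \<le> u \<and> v \<le> b \<and> K \<subseteq> ball t (r t)"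
    if "(t, K) \<in> p" for t K
    using tagged_division_ofD(2-4)[OF p(1) that] fineD[OF p(2) that] by auto
  have ptag: "p tagged_partial_division_of {a..b}"
    using p(1) tagged_division_of_def by blast
  have qtag: "q tagged_partial_division_of {a..b}"
    by (rule tagged_partial_division_subset[OF ptag]) (auto simp: q_def)
  have qdiv: "q tagged_division_of \<Union>(snd ` q)"
    by (rule tagged_partial_division_of_Union_self[OF qtag])
  have D: "snd ` q division_of \<Union>(snd ` q)"
    by (rule division_of_tagged_division[OF qdiv])
  have qsum: "(\<Sum>(t,K)\<in>q. F K) = (\<Sum>K\<in>snd ` q. F K)"
    if F: "\<And>u. F {u..u} = 0" for F :: "real set \<Rightarrow> real"
  proof -
    \<comment> \<open>The lemma applied below asks for the value 0 on every interval with empty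
      interior, including the empty one, where \<open>F\<close> is unconstrained. No piece of
      \<open>q\<close> is empty, so neither sum changes.\<close>
    define F' where "F' K = (if K = {} then 0 else F K)" for K
    have "(\<Sum>(t,K)\<in>q. F K) = (\<Sum>(t,K)\<in>q. F' K)"
      by (intro sum.cong) (auto simp: F'_def q_def dest!: K)
    also have "\<dots> = (\<Sum>K\<in>snd ` q. F' K)"
    proof (rule sum.over_tagged_division_lemma[OF qdiv])
      fix u v :: real assume "box u v = {}"
      then have "v \<le> u" by simp
      then show "F' (cbox u v) = 0" using F by (cases "u = v") (auto simp: F'_def)
    qed
    also have "\<dots> = (\<Sum>K\<in>snd ` q. F K)"
      by (intro sum.cong) (auto simp: F'_def q_def dest!: K)
    finally show ?thesis .
  qed
  have len: "(\<Sum>K\<in>snd ` q. Sup K - Inf K) < \<mu>"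
  proof -
    have "(\<Sum>K\<in>snd ` q. Sup K - Inf K) = (\<Sum>K\<in>snd ` q. measure lebesgue K)"
      by (intro sum.cong) (auto simp: q_def dest!: K)
    also have "\<dots> = measure lebesgue (\<Union>(snd ` q))"
      by (rule content_division[OF D])
    also have "\<dots> \<le> measure lebesgue U"
    proof (rule measure_mono_fmeasurable)
      show "\<Union>(snd ` q) \<subseteq> U" using K rN by (fastforce simp: q_def)
      show "\<Union>(snd ` q) \<in> sets lebesgue" using lmeasurable_division[OF D] by blast
    qed (rule U)
    finally show ?thesis using U by simp
  qed
  have "\<Union>(snd ` q) \<subseteq> {a..b}" using K by (fastforce simp: q_def)
  then have "(\<Sum>K\<in>snd ` q. norm (g (Sup K) - g (Inf K))) < e0 / 4"
    using \<delta>(2)[of "snd ` q"] D len by (simp add: \<mu>_def)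
  then have small: "(\<Sum>(t,K)\<in>q. \<bar>g (Sup K) - g (Inf K)\<bar>) < e0 / 4"
    by (subst qsum) auto
  have lenq: "(\<Sum>(t,K)\<in>q. Sup K - Inf K) < \<mu>"
    using len by (subst qsum) auto
  have sub: "q \<subseteq> p" by (auto simp: q_def)
  have "g b - g a = (\<Sum>(t,K)\<in>p. g (Sup K) - g (Inf K))"
    by (rule additive_tagged_division_1[OF \<open>a \<le> b\<close> p(1), symmetric])
  also have "\<dots> = (\<Sum>(t,K)\<in>p-q. g (Sup K) - g (Inf K)) + (\<Sum>(t,K)\<in>q. g (Sup K) - g (Inf K))"
    by (rule sum.subset_diff[OF sub finp])
  also have "\<dots> \<le> (\<Sum>(t,K)\<in>p-q. (c + e) * (Sup K - Inf K)) + (\<Sum>(t,K)\<in>q. \<bar>g (Sup K) - g (Inf K)\<bar>)"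
  proof (intro add_mono sum_mono)
    fix z assume z: "z \<in> p - q"
    obtain t K where tK: "z = (t, K)" by force
    then obtain u v where uv: "K = {u..v}" "u \<le> t" "t \<le> v" "a \<le> u" "v \<le> b" "K \<subseteq> ball t (r t)"
      using K z by blast
    have "t \<in> {a..b} - N" using z tK uv by (auto simp: q_def)
    moreover have "u \<in> K" "v \<in> K" using uv by auto
    then have "u \<in> ball t (r t)" "v \<in> ball t (r t)" using uv(6) by blast+
    ultimately have "g v - g u \<le> (c + e) * (v - u)"
      using uv by (intro rd) auto
    then show "(case z of (t, K) \<Rightarrow> g (Sup K) - g (Inf K)) \<le> (case z of (t, K) \<Rightarrow> (c + e) * (Sup K - Inf K))"
      using tK uv by auto
  qed auto
  also have "(\<Sum>(t,K)\<in>p-q. (c + e) * (Sup K - Inf K))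
     = (c + e) * ((\<Sum>(t,K)\<in>p. Sup K - Inf K) - (\<Sum>(t,K)\<in>q. Sup K - Inf K))"
    unfolding sum.subset_diff[OF sub finp, of "\<lambda>(t,K). Sup K - Inf K"]
    by (simp add: sum_distrib_left case_prod_unfold)
  also have "(\<Sum>(t,K)\<in>p. Sup K - Inf K) = b - a"
    using additive_tagged_division_1[OF \<open>a \<le> b\<close> p(1), of "\<lambda>x. x"] by simp
  finally have main: "g b - g a \<le> (c + e) * (b - a - (\<Sum>(t,K)\<in>q. Sup K - Inf K)) + e0 / 4"
    using small by linarith
  define l where "l = (\<Sum>(t,K)\<in>q. Sup K - Inf K)"
  have "l \<ge> 0" unfolding l_def by (intro sum_nonneg) (auto simp: q_def dest!: K)
  have "l \<le> e0 / (4 * C)" using lenq by (simp add: l_def \<mu>_def)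
  then have "C * l \<le> e0 / 4" using \<open>C > 0\<close> by (simp add: field_simps)
  moreover have "- c * l \<le> C * l" using \<open>l \<ge> 0\<close> by (intro mult_right_mono) (auto simp: C_def)
  moreover have "e * l \<ge> 0" using \<open>e > 0\<close> \<open>l \<ge> 0\<close> by simp
  ultimately show "g b - g a \<le> c * (b - a) + e0"
    using main e_bound unfolding l_def[symmetric] by (simp add: algebra_simps)
qed

text \<open>On a compact interval \<open>z\<close> is bounded, so its squared distance to
  \<open>w\<close> inherits absolute continuity, with derivative
  \<open>2 * (d \<bullet> (z t - w))\<close> off \<open>N\<close>. Every Lyapunov-type inequality
  below is integrated through this lemma.\<close>

lemma abs_continuous_on_dist_sq_le:
  fixes z :: "real \<Rightarrow> 'a::real_inner"
  assumes ac: "abs_continuous_on {a..b} z" and "a \<le> b" and N: "negligible N"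
    and der: "\<And>t. t \<in> {a..b} - N \<Longrightarrow>
        \<exists>d. (z has_vector_derivative d) (at t within {a..b}) \<and> d \<bullet> (z t - w) \<le> c"
  shows "(norm (z b - w))\<^sup>2 \<le> (norm (z a - w))\<^sup>2 + 2 * c * (b - a)"
proof -
  have "compact (z ` {a..b})"
    by (intro compact_continuous_image abs_continuous_on_imp_continuous_on[OF ac]) simp
  then obtain B where B: "\<forall>t\<in>{a..b}. norm (z t) \<le> B"
    using compact_imp_bounded[of "z ` {a..b}"] by (auto simp: bounded_iff)
  define R where "R = B + norm w"
  have R: "norm (z t - w) \<le> R" if "t \<in> {a..b}" for t
    using B[rule_format, OF that] norm_triangle_ineq4[of "z t" w] by (simp add: R_def)
  define g where "g t = (norm (z t - w))\<^sup>2" for t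
  have "abs_continuous_on {a..b} g"
  proof (rule abs_continuous_on_dominated[OF ac, where C = "2 * R"])
    fix s t assume st: "s \<in> {a..b}" "t \<in> {a..b}"
    have "norm (g t - g s) = \<bar>norm (z t - w) - norm (z s - w)\<bar> * (norm (z t - w) + norm (z s - w))"
      by (simp add: g_def power2_eq_square square_diff_square_factored abs_mult mult.commute)
    also have "\<dots> \<le> norm (z t - z s) * (2 * R)"
    proof (rule mult_mono)
      show "\<bar>norm (z t - w) - norm (z s - w)\<bar> \<le> norm (z t - z s)"
        using norm_triangle_ineq3[of "z t - w" "z s - w"] by simp
    qed (use R[OF st(1)] R[OF st(2)] in auto)
    finally show "norm (g t - g s) \<le> 2 * R * norm (z t - z s)" by (simp add: mult.commute)
  qed
  then have "g b - g a \<le> 2 * c * (b - a)"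
  proof (rule abs_continuous_on_increment_le[OF _ \<open>a \<le> b\<close> N])
    fix t assume "t \<in> {a..b} - N"
    then obtain d where d: "(z has_vector_derivative d) (at t within {a..b})" "d \<bullet> (z t - w) \<le> c"
      using der by blast
    have "(g has_real_derivative 2 * (d \<bullet> (z t - w))) (at t within {a..b})"
      unfolding g_def power2_norm_eq_inner has_field_derivative_def
      by (rule has_derivative_eq_rhs,
          rule has_derivative_inner[OF has_derivative_diff[OF d(1)[unfolded has_vector_derivative_def] has_derivative_const]
               has_derivative_diff[OF d(1)[unfolded has_vector_derivative_def] has_derivative_const]])
         (auto simp: fun_eq_iff inner_commute)
    then show "\<exists>d\<le>2 * c. (g has_real_derivative d) (at t within {a..b})"
      using d(2) by (intro exI[of _ "2 * (d \<bullet> (z t - w))"]) auto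
  qed
  then show ?thesis by (simp add: g_def)
qed

text \<open>Taking the inner product with the total increment \<open>z b - z a\<close> reduces the
  claim to the scalar case; Cauchy-Schwarz bounds the slope.\<close>

lemma abs_continuous_on_norm_diff_le:
  fixes z :: "real \<Rightarrow> 'a::real_inner"
  assumes ac: "abs_continuous_on {a..b} z" and "a \<le> b" and N: "negligible N"
    and der: "\<And>t. t \<in> {a..b} - N \<Longrightarrow>
        \<exists>d. (z has_vector_derivative d) (at t within {a..b}) \<and> norm d \<le> c"
    and "c \<ge> 0"
  shows "norm (z b - z a) \<le> c * (b - a)"
proof -
  define e where "e = z b - z a"
  define g where "g t = z t \<bullet> e" for t
  have "abs_continuous_on {a..b} g"
  proof (rule abs_continuous_on_dominated[OF ac, where C = "norm e"])
    show "norm (g t - g s) \<le> norm e * norm (z t - z s)" for s t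
      using Cauchy_Schwarz_ineq2[of "z t - z s" e]
      by (simp add: g_def inner_diff_left mult.commute)
  qed
  then have "g b - g a \<le> (c * norm e) * (b - a)"
  proof (rule abs_continuous_on_increment_le[OF _ \<open>a \<le> b\<close> N])
    fix t assume "t \<in> {a..b} - N"
    then obtain d where d: "(z has_vector_derivative d) (at t within {a..b})" "norm d \<le> c"
      using der by blast
    have "(g has_real_derivative d \<bullet> e) (at t within {a..b})"
      unfolding g_def has_field_derivative_def
      by (rule has_derivative_eq_rhs,
          rule has_derivative_inner_left[OF d(1)[unfolded has_vector_derivative_def]])
         (auto simp: fun_eq_iff)
    moreover have "d \<bullet> e \<le> c * norm e"
      using norm_cauchy_schwarz[of d e] d(2) mult_right_mono[OF d(2) norm_ge_zero[of e]] by linarith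
    ultimately show "\<exists>d\<le>c * norm e. (g has_real_derivative d) (at t within {a..b})" by blast
  qed
  moreover have "g b - g a = norm e * norm e"
    by (simp add: g_def inner_diff_left[symmetric] e_def[symmetric] norm_eq_sqrt_inner)
  ultimately have "norm e * norm e \<le> norm e * (c * (b - a))" by (simp add: algebra_simps)
  then have "norm e \<le> c * (b - a)"
    using \<open>a \<le> b\<close> \<open>c \<ge> 0\<close> by (cases "e = 0") auto
  then show ?thesis by (simp add: e_def)
qed

subsection \<open>The projection operator\<close>

text \<open>
  Writing \<open>q \<delta>\<close> for the difference quotient, \<open>x + \<delta>' *\<^sub>R q \<delta>\<close> stays in \<open>K\<close> for \<open>\<delta>' \<le> \<delta>\<close>, so \<open>q \<delta>\<close>
  competes with \<open>q \<delta>'\<close> in the projection of \<open>u\<close>: the squared distance from \<open>u\<close> to \<open>q \<delta>\<close> decreases as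
  \<open>\<delta>\<close> decreases, by at least the squared distance between the quotients. Hence the quotients are Cauchy.
\<close>

lemma proj_operator_tendsto:
  fixes K :: "'a::euclidean_space set"
  assumes K: "closed K" "convex K" and x: "x \<in> K"
  shows "((\<lambda>\<delta>::real. (closest_point K (x + \<delta> *\<^sub>R u) - x) /\<^sub>R \<delta>) \<longlongrightarrow> proj_operator K x u) (at_right 0)"
proof -
  define q where "q \<delta> = (closest_point K (x + \<delta> *\<^sub>R u) - x) /\<^sub>R \<delta>" for \<delta> :: real
  define D where "D \<delta> = (norm (u - q \<delta>))\<^sup>2" for \<delta>
  have q: "closest_point K (x + \<delta> *\<^sub>R u) = x + \<delta> *\<^sub>R q \<delta>" if "\<delta> > 0" for \<delta>
    using that by (simp add: q_def)
  have step: "(norm (q \<delta> - q \<delta>'))\<^sup>2 \<le> D \<delta> - D \<delta>'" if d: "0 < \<delta>'" "\<delta>' \<le> \<delta>" for \<delta> \<delta>'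
  proof -
    have inK: "x + \<delta> *\<^sub>R q \<delta> \<in> K"
      using q[of \<delta>] d closest_point_in_set[OF K(1), of "x + \<delta> *\<^sub>R u"] x by auto
    have "(1 - \<delta>' / \<delta>) *\<^sub>R x + (\<delta>' / \<delta>) *\<^sub>R (x + \<delta> *\<^sub>R q \<delta>) \<in> K"
      using d by (intro convexD[OF K(2) x inK]) (auto simp: field_simps)
    moreover have "(1 - \<delta>' / \<delta>) *\<^sub>R x + (\<delta>' / \<delta>) *\<^sub>R (x + \<delta> *\<^sub>R q \<delta>) = x + \<delta>' *\<^sub>R q \<delta>"
      using d by (simp add: algebra_simps)
    ultimately have "(x + \<delta>' *\<^sub>R u - closest_point K (x + \<delta>' *\<^sub>R u)) \<bullet>
        (x + \<delta>' *\<^sub>R q \<delta> - closest_point K (x + \<delta>' *\<^sub>R u)) \<le> 0"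
      using closest_point_dot[OF K(2,1)] by metis
    then have "(\<delta>' *\<^sub>R (u - q \<delta>')) \<bullet> (\<delta>' *\<^sub>R (q \<delta> - q \<delta>')) \<le> 0"
      using q[OF d(1)] by (simp add: algebra_simps)
    then have "\<delta>' * (\<delta>' * ((u - q \<delta>') \<bullet> (q \<delta> - q \<delta>'))) \<le> 0" by simp
    then have "(u - q \<delta>') \<bullet> (q \<delta> - q \<delta>') \<le> 0"
      using d(1) by (simp add: mult_le_0_iff)
    moreover have "D \<delta> = D \<delta>' + (norm (q \<delta> - q \<delta>'))\<^sup>2 - 2 * ((u - q \<delta>') \<bullet> (q \<delta> - q \<delta>'))"
      by (simp add: D_def power2_norm_eq_inner inner_diff_left inner_diff_right inner_commute)
    ultimately show ?thesis by simp
  qed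
  define I where "I = Inf (D ` {0<..})"
  have bdd: "bdd_below (D ` {0<..})" by (rule bdd_belowI[of _ 0]) (auto simp: D_def)
  have I: "I \<le> D \<delta>" if "\<delta> > 0" for \<delta>
    unfolding I_def using that by (intro cInf_lower bdd) auto
  have "cauchy_filter (filtermap q (at_right 0))"
    unfolding cauchy_filter_metric_filtermap
  proof (intro allI impI)
    fix e :: real assume "e > 0"
    then have "I < I + (e / 2)\<^sup>2" by simp
    \<comment> \<open>By \<open>step\<close>, every quotient with a smaller parameter lies within
      the square root of \<open>D \<delta>0 - I\<close> of \<open>q \<delta>0\<close>.\<close>
    then obtain \<delta>0 where d0: "\<delta>0 > 0" "D \<delta>0 < I + (e / 2)\<^sup>2"
      using cInf_lessD[of "D ` {0<..}" "I + (e / 2)\<^sup>2"] unfolding I_def by auto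
    have near: "dist (q \<delta>) (q \<delta>0) < e / 2" if "0 < \<delta> \<and> \<delta> < \<delta>0" for \<delta>
    proof -
      have "(norm (q \<delta>0 - q \<delta>))\<^sup>2 < (e / 2)\<^sup>2"
        using step[of \<delta> \<delta>0] I[of \<delta>] that d0 by simp
      then have "norm (q \<delta>0 - q \<delta>) < e / 2"
        by (rule power2_less_imp_less) (use \<open>e > 0\<close> in simp)
      then show ?thesis by (simp add: dist_norm norm_minus_commute)
    qed
    have "dist (q s) (q t) < e" if "0 < s \<and> s < \<delta>0" "0 < t \<and> t < \<delta>0" for s t
      using dist_triangle_half_r[of "q \<delta>0" "q s" e "q t"] near[OF that(1)] near[OF that(2)]
      by (simp add: dist_commute)
    moreover have "eventually (\<lambda>s. 0 < s \<and> s < \<delta>0) (at_right 0)"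
      using d0(1) by (auto simp: eventually_at_right_field)
    ultimately show "\<exists>P. eventually P (at_right 0) \<and> (\<forall>x y. P x \<and> P y \<longrightarrow> dist (q x) (q y) < e)"
      by (intro exI[of _ "\<lambda>s. 0 < s \<and> s < \<delta>0"]) auto
  qed
  moreover have "filtermap q (at_right 0) \<noteq> bot" by (simp add: filtermap_bot_iff)
  moreover have "\<forall>F. F \<noteq> bot \<longrightarrow> cauchy_filter F \<longrightarrow> (\<exists>p::'a. F \<le> nhds p)"
    using complete_UNIV unfolding complete_uniform by simp
  ultimately obtain p where "filtermap q (at_right 0) \<le> nhds p" by blast
  then have lim: "(q \<longlongrightarrow> p) (at_right 0)" by (simp add: filterlim_def)
  have "proj_operator K x u = p"
    unfolding proj_operator_def using lim by (intro tendsto_Lim) (auto simp: q_def[abs_def])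
  then show ?thesis using lim by (simp add: q_def[abs_def])
qed

text \<open>This is the obtuse-angle property of the projection of
  \<open>x + \<delta> *\<^sub>R u\<close>, divided by \<open>\<delta>\<close> and passed to the
  limit.\<close>

lemma proj_operator_dot:
  fixes K :: "'a::euclidean_space set"
  assumes K: "closed K" "convex K" and x: "x \<in> K" and y: "y \<in> K"
  shows "(u - proj_operator K x u) \<bullet> (y - x) \<le> 0"
proof -
  define q where "q \<delta> = (closest_point K (x + \<delta> *\<^sub>R u) - x) /\<^sub>R \<delta>" for \<delta> :: real
  have q: "(q \<longlongrightarrow> proj_operator K x u) (at_right 0)"
    using proj_operator_tendsto[OF K x] by (simp add: q_def[abs_def])
  have "((\<lambda>\<delta>. (u - q \<delta>) \<bullet> (y - x - \<delta> *\<^sub>R q \<delta>)) \<longlongrightarrow>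
      (u - proj_operator K x u) \<bullet> (y - x - 0 *\<^sub>R proj_operator K x u)) (at_right 0)"
    by (intro tendsto_intros q)
  moreover have "(u - q \<delta>) \<bullet> (y - x - \<delta> *\<^sub>R q \<delta>) \<le> 0" if "\<delta> > 0" for \<delta>
  proof -
    have "closest_point K (x + \<delta> *\<^sub>R u) = x + \<delta> *\<^sub>R q \<delta>" using that by (simp add: q_def)
    then have "(x + \<delta> *\<^sub>R u - (x + \<delta> *\<^sub>R q \<delta>)) \<bullet> (y - (x + \<delta> *\<^sub>R q \<delta>)) \<le> 0"
      using closest_point_dot[OF K(2,1) y] by metis
    then have "(\<delta> *\<^sub>R (u - q \<delta>)) \<bullet> (y - x - \<delta> *\<^sub>R q \<delta>) \<le> 0"
      by (simp add: algebra_simps)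
    then show ?thesis using that by (simp add: mult_le_0_iff)
  qed
  then have "\<forall>\<^sub>F \<delta> in at_right 0. (u - q \<delta>) \<bullet> (y - x - \<delta> *\<^sub>R q \<delta>) \<le> 0"
    by (intro eventually_mono[OF eventually_at_right_less])
  ultimately have "(u - proj_operator K x u) \<bullet> (y - x - 0 *\<^sub>R proj_operator K x u) \<le> 0"
    by (rule tendsto_upperbound) simp
  then show ?thesis by simp
qed

text \<open>The projection is nonexpansive and fixes \<open>x\<close>, so every difference quotient
  satisfies the bound.\<close>

lemma norm_proj_operator_le:
  fixes K :: "'a::euclidean_space set"
  assumes K: "closed K" "convex K" and x: "x \<in> K"
  shows "norm (proj_operator K x u) \<le> norm u"
proof -
  have "norm ((closest_point K (x + \<delta> *\<^sub>R u) - x) /\<^sub>R \<delta>) \<le> norm u" if "\<delta> > 0" for \<delta> :: real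
  proof -
    have "norm (closest_point K (x + \<delta> *\<^sub>R u) - x) \<le> \<delta> * norm u"
      using closest_point_lipschitz[OF K(2,1), of "x + \<delta> *\<^sub>R u" x] closest_point_self[OF x] x that
      by (auto simp: dist_norm)
    then have "inverse \<delta> * norm (closest_point K (x + \<delta> *\<^sub>R u) - x) \<le> norm u"
      using that by (simp add: field_simps)
    then show ?thesis using that by simp
  qed
  then have "\<forall>\<^sub>F \<delta>::real in at_right 0. norm ((closest_point K (x + \<delta> *\<^sub>R u) - x) /\<^sub>R \<delta>) \<le> norm u"
    by (intro eventually_mono[OF eventually_at_right_less])
  then show ?thesis
    by (intro tendsto_upperbound[OF tendsto_norm[OF proj_operator_tendsto[OF K x]]]) auto
qed

subsection \<open>Saddle points and Slater's condition\<close>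

text \<open>Restricting \<open>f\<close> to the line through \<open>x\<close> and \<open>y\<close>
  reduces this to the tangent inequality in one variable.\<close>

lemma convex_on_GDERIV_above_tangent:
  assumes f: "convex_on UNIV f" and d: "GDERIV f x :> d"
  shows "f x + d \<bullet> (y - x) \<le> f y"
proof -
  define h where "h t = f (x + t *\<^sub>R (y - x))" for t :: real
  have "((\<lambda>t. x + t *\<^sub>R (y - x)) has_derivative (\<lambda>t. t *\<^sub>R (y - x))) (at 0)"
    by (auto intro!: derivative_eq_intros)
  moreover have "(f has_derivative (\<lambda>w. w \<bullet> d)) (at (x + 0 *\<^sub>R (y - x)))"
    using d by (simp add: gderiv_def)
  ultimately have "(h has_derivative (\<lambda>t. (t *\<^sub>R (y - x)) \<bullet> d)) (at 0)"
    unfolding h_def by (rule has_derivative_compose)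
  then have h': "(h has_real_derivative d \<bullet> (y - x)) (at 0)"
    by (simp add: has_field_derivative_def inner_commute mult_commute_abs)
  have "convex_on UNIV h"
  proof (intro convex_onI)
    fix t s1 s2 :: real assume t: "0 < t" "t < 1"
    have "x + ((1 - t) * s1 + t * s2) *\<^sub>R (y - x)
        = (1 - t) *\<^sub>R (x + s1 *\<^sub>R (y - x)) + t *\<^sub>R (x + s2 *\<^sub>R (y - x))"
      by (simp add: algebra_simps)
    then show "h ((1 - t) *\<^sub>R s1 + t *\<^sub>R s2) \<le> (1 - t) * h s1 + t * h s2"
      using convex_onD[OF f, of t "x + s1 *\<^sub>R (y - x)" "x + s2 *\<^sub>R (y - x)"] t
      by (simp add: h_def)
  qed auto
  then have "h 1 - h 0 \<ge> (d \<bullet> (y - x)) * (1 - 0)"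
    using h' by (intro convex_on_imp_above_tangent[of UNIV]) auto
  then show ?thesis by (simp add: h_def)
qed

lemma saddle_pointI:
  assumes "xs \<in> K" "A *v xs = b" "\<And>y. y \<in> K \<Longrightarrow> f xs \<le> f y + vs \<bullet> (A *v y - b)"
  shows "saddle_point K f A b xs vs"
  using assms by (simp add: saddle_point_def lagrangian_def)

text \<open>The Lagrangian is affine in the multiplier; moving \<open>vs\<close> in the direction of
  the residual \<open>r\<close> would increase it unless \<open>r = 0\<close>.\<close>

lemma saddle_pointD:
  fixes A :: "real^'n^'m"
  assumes "saddle_point K f A b xs vs"
  shows "xs \<in> K" "A *v xs = b" "\<And>y. y \<in> K \<Longrightarrow> f xs \<le> f y + vs \<bullet> (A *v y - b)"
proof -
  show xs: "xs \<in> K" using assms by (simp add: saddle_point_def)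
  define r where "r = A *v xs - b"
  have "(vs + r) \<bullet> r \<le> vs \<bullet> r"
    using assms xs by (auto simp: saddle_point_def lagrangian_def r_def)
  then have "r \<bullet> r \<le> 0" by (simp add: inner_add_left)
  then have "r = 0" by (metis inner_eq_zero_iff inner_ge_zero order_antisym)
  then show "A *v xs = b" by (simp add: r_def)
  then show "f xs \<le> f y + vs \<bullet> (A *v y - b)" if "y \<in> K" for y
    using assms that by (auto simp: saddle_point_def lagrangian_def)
qed

text \<open>
  The multiplier is read off a hyperplane supporting the set of perturbed values at \<open>0\<close>. As Slater's
  point is only required to lie in the relative interior of \<open>K\<close>, the hyperplane must be a proper
  one (strict on the relative interior) for its first component to be nonzero.
\<close>

lemma slater_imp_saddle_point:
  fixes A :: "real^'n^'m"
  assumes K: "convex K" and f: "convex_on UNIV f"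
    and slater: "slater_condition K A b" and opt: "optimal_solution K f A b xs"
  obtains vs where "saddle_point K f A b xs vs"
proof -
  have xs: "xs \<in> K" "A *v xs = b" and min: "\<And>y. y \<in> K \<Longrightarrow> A *v y = b \<Longrightarrow> f xs \<le> f y"
    using opt by (auto simp: optimal_solution_def)
  \<comment> \<open>Pairs of an upper bound for the excess over the optimal value and a constraint
    violation. Keeping all larger \<open>r\<close> makes the set convex.\<close>
  define S where "S = {(r, A *v y - b) | r y. y \<in> K \<and> f y - f xs \<le> r}"
  have SI: "(r, A *v y - b) \<in> S" if "y \<in> K" "f y - f xs \<le> r" for r y
    using that by (auto simp: S_def)
  have "convex S"
  proof (rule convexI)
    fix p q :: "real \<times> (real^'m)" and s t :: real
    assume pq: "p \<in> S" "q \<in> S" and st: "0 \<le> s" "0 \<le> t" "s + t = 1"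
    obtain r1 y1 where 1: "p = (r1, A *v y1 - b)" "y1 \<in> K" "f y1 - f xs \<le> r1"
      using pq(1) by (auto simp: S_def)
    obtain r2 y2 where 2: "q = (r2, A *v y2 - b)" "y2 \<in> K" "f y2 - f xs \<le> r2"
      using pq(2) by (auto simp: S_def)
    have s: "s = 1 - t" using st by simp
    have "f (s *\<^sub>R y1 + t *\<^sub>R y2) \<le> s * f y1 + t * f y2"
      using convex_onD[OF f, of t y1 y2] st s by simp
    also have "\<dots> \<le> s * (r1 + f xs) + t * (r2 + f xs)"
      using 1 2 st by (intro add_mono mult_left_mono) auto
    also have "\<dots> = s * r1 + t * r2 + f xs" by (simp add: s algebra_simps)
    finally have "(s * r1 + t * r2, A *v (s *\<^sub>R y1 + t *\<^sub>R y2) - b) \<in> S"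
      using convexD[OF K 1(2) 2(2) st] by (intro SI) auto
    moreover have "A *v (s *\<^sub>R y1 + t *\<^sub>R y2) - b = s *\<^sub>R (A *v y1 - b) + t *\<^sub>R (A *v y2 - b)"
      by (simp add: s matrix_vector_right_distrib matrix_vector_mult_scaleR algebra_simps)
    ultimately show "s *\<^sub>R p + t *\<^sub>R q \<in> S" by (simp add: 1 2)
  qed
  have S0: "(r, 0) \<in> S" if "r \<ge> 0" for r using SI[OF xs(1), of r] that xs by simp
  \<comment> \<open>Otherwise the segment from \<open>(1, 0)\<close> could be prolonged past the
    origin inside \<open>S\<close>, giving a feasible point with a value below the optimum.\<close>
  have "(0, 0) \<notin> rel_interior S"
  proof
    assume "(0, 0) \<in> rel_interior S"
    then obtain e where "e > 1" "(1 - e) *\<^sub>R (1, 0) + e *\<^sub>R (0, 0) \<in> S"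
      using convex_rel_interior_iff[OF \<open>convex S\<close>] S0[of 1] by fastforce
    then obtain y where "y \<in> K" "f y - f xs < 0" "A *v y - b = 0" by (auto simp: S_def)
    then show False using min[of y] by simp
  qed
  then obtain a where a: "\<And>y. y \<in> S \<Longrightarrow> a \<bullet> (0, 0) \<le> a \<bullet> y"
      "\<And>y. y \<in> rel_interior S \<Longrightarrow> a \<bullet> (0, 0) < a \<bullet> y"
    using supporting_hyperplane_rel_boundary[OF \<open>convex S\<close> S0[of 0]] by (metis order_refl)
  obtain \<mu> w where a_eq: "a = (\<mu>, w)" by force
  have nonneg: "\<mu> * r + w \<bullet> (A *v y - b) \<ge> 0" if "y \<in> K" "f y - f xs \<le> r" for r y
    using a(1)[OF SI[OF that]] by (simp add: a_eq)
  have "\<mu> \<ge> 0" using a(1)[OF S0[of 1]] by (simp add: a_eq)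
  \<comment> \<open>If \<open>\<mu> = 0\<close>, then \<open>w \<bullet> (A *v y - b)\<close> is
    nonnegative on \<open>K\<close> and zero at Slater's point \<open>z\<close>. Prolonging segments
    past \<open>z\<close> makes it vanish on \<open>K\<close>, so the hyperplane would contain
    \<open>S\<close>.\<close>
  moreover have "\<mu> \<noteq> 0"
  proof
    assume \<mu>: "\<mu> = 0"
    obtain z where z: "z \<in> rel_interior K" "A *v z = b" using slater by (auto simp: slater_condition_def)
    have ge: "w \<bullet> (A *v y - b) \<ge> 0" if "y \<in> K" for y using nonneg[OF that order_refl] \<mu> by simp
    have "w \<bullet> (A *v y - b) = 0" if y: "y \<in> K" for y
    proof -
      obtain e where e: "e > 1" "(1 - e) *\<^sub>R y + e *\<^sub>R z \<in> K"
        using convex_rel_interior_iff[OF K] z(1) y by blast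
      have "w \<bullet> (A *v ((1 - e) *\<^sub>R y + e *\<^sub>R z) - b) = (1 - e) * (w \<bullet> (A *v y - b))"
        by (simp add: z(2) matrix_vector_right_distrib matrix_vector_mult_scaleR
            inner_diff_right inner_add_right algebra_simps)
      then have "(1 - e) * (w \<bullet> (A *v y - b)) \<ge> 0" using ge[OF e(2)] by simp
      then show ?thesis using e(1) ge[OF y] by (auto simp: zero_le_mult_iff)
    qed
    then have "a \<bullet> p = 0" if "p \<in> S" for p using that \<mu> by (auto simp: S_def a_eq)
    moreover obtain p where "p \<in> rel_interior S"
      using rel_interior_eq_empty[OF \<open>convex S\<close>] S0[of 0] by blast
    ultimately show False using a(2)[of p] rel_interior_subset[of S] by (fastforce simp: zero_prod_def[symmetric])
  qed
  ultimately have "\<mu> > 0" by simp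
  have "saddle_point K f A b xs (w /\<^sub>R \<mu>)"
  proof (rule saddle_pointI[OF xs])
    fix y assume "y \<in> K"
    then have "\<mu> * (f y - f xs) + w \<bullet> (A *v y - b) \<ge> 0" using nonneg by blast
    then have "(\<mu> * (f y - f xs) + w \<bullet> (A *v y - b)) / \<mu> \<ge> 0" using \<open>\<mu> > 0\<close> by simp
    then show "f xs \<le> f y + (w /\<^sub>R \<mu>) \<bullet> (A *v y - b)"
      using \<open>\<mu> > 0\<close> by (simp add: field_simps)
  qed
  then show ?thesis using that by blast
qed

subsection \<open>The projected primal-dual flow\<close>

text \<open>Both differential equations hold off one common null set \<open>N\<close>, the form that
  the increment lemmas take.\<close>

locale primal_dual_flow =
  fixes K :: "(real^'n) set" and f :: "real^'n \<Rightarrow> real" and gradf :: "real^'n \<Rightarrow> real^'n"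
    and A :: "real^'n^'m" and b :: "real^'m"
    and x :: "real \<Rightarrow> real^'n" and v :: "real \<Rightarrow> real^'m" and N :: "real set"
  assumes closed_K: "closed K" and convex_K: "convex K"
    and convex_f: "convex_on UNIV f"
    and gradf: "\<And>y. GDERIV f y :> gradf y"
    and continuous_gradf: "continuous_on UNIV gradf"
    and x_in_K: "\<And>t. t \<ge> 0 \<Longrightarrow> x t \<in> K"
    and ac_x: "\<And>T. T > 0 \<Longrightarrow> abs_continuous_on {0..T} x"
    and ac_v: "\<And>T. T > 0 \<Longrightarrow> abs_continuous_on {0..T} v"
    and negligible_N: "negligible N"
    and x_deriv: "\<And>t. t \<ge> 0 \<Longrightarrow> t \<notin> N \<Longrightarrow>
          (x has_vector_derivative
             proj_operator K (x t)
               (- gradf (x t) - transpose A *v v t - transpose A *v (A *v x t - b)))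
            (at t within {0..})"
    and v_deriv: "\<And>t. t \<ge> 0 \<Longrightarrow> t \<notin> N \<Longrightarrow>
          (v has_vector_derivative (A *v x t - b)) (at t within {0..})"
begin

definition drift :: "real \<Rightarrow> real^'n" where
  "drift t = - gradf (x t) - transpose A *v v t - transpose A *v (A *v x t - b)"

definition xdot :: "real \<Rightarrow> real^'n" where
  "xdot t = proj_operator K (x t) (drift t)"

definition res :: "real \<Rightarrow> real^'m" where
  "res t = A *v x t - b"

section \<open>Restriction of the trajectory to compact time intervals\<close>

lemma ac_x_Icc: "0 \<le> s \<Longrightarrow> abs_continuous_on {s..t} x"
  by (rule abs_continuous_on_subset[OF ac_x[of "\<bar>t\<bar> + 1"]]) auto

lemma ac_v_Icc: "0 \<le> s \<Longrightarrow> abs_continuous_on {s..t} v"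
  by (rule abs_continuous_on_subset[OF ac_v[of "\<bar>t\<bar> + 1"]]) auto

lemma x_deriv_Icc:
  assumes "0 \<le> s" "r \<in> {s..t} - N"
  shows "(x has_vector_derivative xdot r) (at r within {s..t})"
  using assms has_vector_derivative_within_subset[OF x_deriv[of r], of "{s..t}"]
  by (auto simp: xdot_def drift_def)

lemma v_deriv_Icc:
  assumes "0 \<le> s" "r \<in> {s..t} - N"
  shows "(v has_vector_derivative res r) (at r within {s..t})"
  using assms has_vector_derivative_within_subset[OF v_deriv[of r], of "{s..t}"]
  by (auto simp: res_def)

lemma continuous_f: "continuous_on UNIV f"
  using gradf unfolding gderiv_def
  by (meson continuous_at_imp_continuous_on has_derivative_continuous)

text \<open>Normality replaces the velocity by the drift. The penalty term merges into the
  multiplier \<open>v t + res t\<close>, and by convexity of \<open>f\<close> the bound is the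
  change, from \<open>x t\<close> to \<open>y\<close>, of the Lagrangian with that
  multiplier.\<close>

lemma xdot_dot_le:
  assumes "t \<ge> 0" "y \<in> K"
  shows "xdot t \<bullet> (x t - y) \<le> f y - f (x t) + (v t + res t) \<bullet> (A *v y - A *v x t)"
proof -
  have "(drift t - xdot t) \<bullet> (y - x t) \<le> 0"
    unfolding xdot_def using proj_operator_dot[OF closed_K convex_K] x_in_K assms by blast
  then have "xdot t \<bullet> (x t - y) \<le> drift t \<bullet> (x t - y)"
    by (simp add: inner_diff_left inner_diff_right)
  also have "\<dots> = gradf (x t) \<bullet> (y - x t) + (v t + res t) \<bullet> (A *v y - A *v x t)"
    unfolding drift_def res_def[symmetric] transpose_matrix_vector
    by (simp add: inner_diff_left inner_diff_right inner_add_left dot_lmul_matrix)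
  also have "\<dots> \<le> f y - f (x t) + (v t + res t) \<bullet> (A *v y - A *v x t)"
    using convex_on_GDERIV_above_tangent[OF convex_f gradf, of "x t" y] by simp
  finally show ?thesis .
qed

text \<open>
  The rate at which half the squared distance of the trajectory to the saddle point \<open>(xs, vs)\<close> is
  guaranteed to decrease; it depends on the primal variable only.
\<close>

definition gap :: "real^'n \<Rightarrow> real^'m \<Rightarrow> real^'n \<Rightarrow> real" where
  "gap xs vs y = f y + vs \<bullet> (A *v y - b) - f xs + (norm (A *v y - b))\<^sup>2"

definition energy :: "real^'n \<Rightarrow> real^'m \<Rightarrow> real \<Rightarrow> real" where
  "energy xs vs t = (norm ((x t, v t) - (xs, vs)))\<^sup>2"

lemma continuous_gap: "continuous_on S (gap xs vs)"
  unfolding gap_def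
  by (intro continuous_intros continuous_on_subset[OF continuous_f]
      linear_continuous_on matrix_vector_mul_bounded_linear) auto

lemma gap_ge_residual:
  assumes "saddle_point K f A b xs vs" "y \<in> K"
  shows "(norm (A *v y - b))\<^sup>2 \<le> gap xs vs y"
  using saddle_pointD(3)[OF assms] by (simp add: gap_def)

lemma gap_nonneg:
  assumes "saddle_point K f A b xs vs" "y \<in> K"
  shows "0 \<le> gap xs vs y"
  using gap_ge_residual[OF assms] by (meson order_trans zero_le_power2)

text \<open>In \<open>xdot_dot_le\<close> with \<open>y = xs\<close>, feasibility of
  \<open>xs\<close> makes the term in \<open>v\<close> cancel against
  \<open>res r \<bullet> v r\<close> from the dual equation, leaving exactly \<open>- gap\<close>.
  The factor 2 appears because \<open>energy\<close> is not halved.\<close>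

lemma energy_decrease:
  assumes saddle: "saddle_point K f A b xs vs" and st: "0 \<le> s" "s \<le> t"
    and c: "\<And>r. r \<in> {s..t} \<Longrightarrow> c \<le> gap xs vs (x r)"
  shows "energy xs vs t \<le> energy xs vs s - 2 * c * (t - s)"
proof -
  note xs = saddle_pointD[OF saddle]
  have "(norm ((x t, v t) - (xs, vs)))\<^sup>2 \<le> (norm ((x s, v s) - (xs, vs)))\<^sup>2 + 2 * (- c) * (t - s)"
  proof (rule abs_continuous_on_dist_sq_le[OF abs_continuous_on_Pair[OF ac_x_Icc ac_v_Icc] st(2) negligible_N])
    fix r assume r: "r \<in> {s..t} - N"
    have "((\<lambda>r. (x r, v r)) has_vector_derivative (xdot r, res r)) (at r within {s..t})"
      using x_deriv_Icc[OF st(1) r] v_deriv_Icc[OF st(1) r] by (rule has_vector_derivative_Pair)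
    moreover have "(xdot r, res r) \<bullet> ((x r, v r) - (xs, vs)) \<le> - c"
    proof -
      have "xdot r \<bullet> (x r - xs) \<le> f xs - f (x r) + (v r + res r) \<bullet> (- res r)"
        using xdot_dot_le[of r xs] r st xs(1,2) by (simp add: res_def)
      then have "xdot r \<bullet> (x r - xs) + res r \<bullet> (v r - vs) \<le> - gap xs vs (x r)"
        unfolding gap_def res_def[symmetric] power2_norm_eq_inner
        by (simp add: inner_add_left inner_add_right inner_diff_left inner_diff_right inner_commute)
      then show ?thesis using c[of r] r by simp
    qed
    ultimately show "\<exists>d. ((\<lambda>r. (x r, v r)) has_vector_derivative d) (at r within {s..t}) \<and>
        d \<bullet> ((x r, v r) - (xs, vs)) \<le> - c" by blast
  qed (rule st(1))+
  then show ?thesis by (simp add: energy_def)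
qed

lemma energy_antimono:
  assumes saddle: "saddle_point K f A b xs vs" and st: "0 \<le> s" "s \<le> t"
  shows "energy xs vs t \<le> energy xs vs s"
  using energy_decrease[OF saddle st, of 0] gap_nonneg[OF saddle x_in_K] st by auto

lemma v_increment_le:
  assumes st: "0 \<le> s" "s \<le> t" and c: "c \<ge> 0" "\<And>r. r \<in> {s..t} \<Longrightarrow> norm (res r) \<le> c"
  shows "norm (v t - v s) \<le> c * (t - s)"
  by (rule abs_continuous_on_norm_diff_le[OF ac_v_Icc[OF st(1)] st(2) negligible_N])
     (use v_deriv_Icc[OF st(1)] c in auto)

section \<open>Boundedness and Lipschitz continuity of the trajectory\<close>

lemma trajectory_bounded:
  assumes saddle: "saddle_point K f A b xs vs"
  obtains R where "\<And>t. t \<ge> 0 \<Longrightarrow> norm (x t, v t) \<le> R"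
proof -
  have "norm (x t, v t) \<le> norm ((x 0, v 0) - (xs, vs)) + norm (xs, vs)" if "t \<ge> 0" for t
  proof -
    have "norm ((x t, v t) - (xs, vs)) \<le> norm ((x 0, v 0) - (xs, vs))"
      using energy_antimono[OF saddle order_refl that] unfolding energy_def
      by (rule power2_le_imp_le) simp
    then show ?thesis using norm_triangle_sub[of "(x t, v t)" "(xs, vs)"] by linarith
  qed
  then show ?thesis using that by blast
qed

text \<open>The drift is a continuous function \<open>F\<close> of the bounded pair
  \<open>(x, v)\<close>, hence bounded, and projecting it does not increase its norm.\<close>

lemma x_lipschitz:
  assumes saddle: "saddle_point K f A b xs vs"
  obtains L where "L \<ge> 0" "\<And>s t. 0 \<le> s \<Longrightarrow> s \<le> t \<Longrightarrow> norm (x t - x s) \<le> L * (t - s)"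
proof -
  obtain R where R: "\<And>t. t \<ge> 0 \<Longrightarrow> norm (x t, v t) \<le> R"
    by (rule trajectory_bounded[OF saddle]) (rule that)
  define F where "F = (\<lambda>p. - gradf (fst p) - transpose A *v snd p - transpose A *v (A *v fst p - b))"
  have "continuous_on UNIV (\<lambda>p :: (real^'n) \<times> (real^'m). gradf (fst p))"
    by (rule continuous_on_compose2[OF continuous_gradf]) (auto intro: continuous_intros)
  then have "continuous_on UNIV F"
    unfolding F_def
    by (intro continuous_intros bounded_linear.continuous_on[OF matrix_vector_mul_bounded_linear])
  then have "compact (F ` cball 0 R)"
    by (intro compact_continuous_image) (auto intro: continuous_on_subset)
  then obtain L where L: "L > 0" "\<And>p. p \<in> cball 0 R \<Longrightarrow> norm (F p) \<le> L"
    using compact_imp_bounded[of "F ` cball 0 R"] by (auto simp: bounded_pos)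
  have xdot: "norm (xdot t) \<le> L" if "t \<ge> 0" for t
  proof -
    have "norm (xdot t) \<le> norm (drift t)"
      unfolding xdot_def by (rule norm_proj_operator_le[OF closed_K convex_K x_in_K[OF that]])
    also have "drift t = F (x t, v t)" by (simp add: drift_def F_def)
    also have "norm \<dots> \<le> L" using R[OF that] by (intro L) simp
    finally show ?thesis .
  qed
  have "norm (x t - x s) \<le> L * (t - s)" if "0 \<le> s" "s \<le> t" for s t
  proof (rule abs_continuous_on_norm_diff_le[OF ac_x_Icc[OF that(1)] that(2) negligible_N])
    fix r assume r: "r \<in> {s..t} - N"
    then have "norm (xdot r) \<le> L" using xdot that by simp
    then show "\<exists>d. (x has_vector_derivative d) (at r within {s..t}) \<and> norm d \<le> L"
      using x_deriv_Icc[OF that(1) r] by blast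
  qed (use L(1) in simp)
  then show ?thesis using that[of L] L(1) by simp
qed

text \<open>A late time with gap at least \<open>\<epsilon>\<close> would force the gap to stay
  large for a fixed duration, and so an energy drop that the nearly exhausted energy cannot
  afford.\<close>

lemma gap_tendsto_0:
  assumes saddle: "saddle_point K f A b xs vs"
  shows "((\<lambda>t. gap xs vs (x t)) \<longlongrightarrow> 0) at_top"
proof (rule tendstoI)
  fix \<epsilon> :: real assume "\<epsilon> > 0"
  obtain R where R: "\<And>t. t \<ge> 0 \<Longrightarrow> norm (x t, v t) \<le> R"
    by (rule trajectory_bounded[OF saddle]) (rule that)
  have xR: "x t \<in> cball 0 R" if "t \<ge> 0" for t
    using R[OF that] norm_fst_le[of "x t" "v t"] by simp
  obtain L where L: "L \<ge> 0" "\<And>s t. 0 \<le> s \<Longrightarrow> s \<le> t \<Longrightarrow> norm (x t - x s) \<le> L * (t - s)"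
    by (rule x_lipschitz[OF saddle]) (rule that)
  have "uniformly_continuous_on (cball 0 R) (gap xs vs)"
    by (intro compact_uniformly_continuous continuous_gap compact_cball)
  then obtain d where d: "d > 0"
    "\<And>p q. p \<in> cball 0 R \<Longrightarrow> q \<in> cball 0 R \<Longrightarrow> dist q p < d \<Longrightarrow> dist (gap xs vs q) (gap xs vs p) < \<epsilon> / 2"
    unfolding uniformly_continuous_on_def using \<open>\<epsilon> > 0\<close> by (metis half_gt_zero)
  \<comment> \<open>Within time \<open>h\<close> the curve \<open>x\<close> moves by less than
    \<open>d\<close>, so the gap changes by less than \<open>\<epsilon> / 2\<close>;
    \<open>L + 1\<close> covers \<open>L = 0\<close>.\<close>
  define h where "h = d / (L + 1)"
  have h: "h > 0" "L * h < d" using d(1) L(1) by (auto simp: h_def field_simps)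
  define I where "I = Inf (energy xs vs ` {0..})"
  have bdd: "bdd_below (energy xs vs ` {0..})"
    by (rule bdd_belowI[of _ 0]) (auto simp: energy_def)
  have I: "I \<le> energy xs vs t" if "t \<ge> 0" for t
    unfolding I_def using that by (intro cInf_lower bdd) auto
  have "I < I + \<epsilon> * h" using \<open>\<epsilon> > 0\<close> h by simp
  \<comment> \<open>From \<open>t0\<close> on, the energy can no longer fall by
    \<open>\<epsilon> * h\<close>.\<close>
  then obtain t0 where t0: "t0 \<ge> 0" "energy xs vs t0 < I + \<epsilon> * h"
    using cInf_lessD[of "energy xs vs ` {0..}" "I + \<epsilon> * h"] unfolding I_def by auto
  have "gap xs vs (x t) < \<epsilon>" if "t \<ge> t0" for t
  proof (rule ccontr)
    assume "\<not> gap xs vs (x t) < \<epsilon>"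
    then have ge: "gap xs vs (x t) \<ge> \<epsilon>" by simp
    have "\<epsilon> / 2 \<le> gap xs vs (x r)" if r: "r \<in> {t..t + h}" for r
    proof -
      have "norm (x r - x t) \<le> L * (r - t)" using L(2)[of t r] r t0 \<open>t \<ge> t0\<close> by auto
      also have "\<dots> \<le> L * h" using r L(1) by (intro mult_left_mono) auto
      finally have "dist (x r) (x t) < d" using h by (simp add: dist_norm)
      then have "dist (gap xs vs (x r)) (gap xs vs (x t)) < \<epsilon> / 2"
        using d(2) xR r t0 \<open>t \<ge> t0\<close> by simp
      then show ?thesis using ge unfolding dist_real_def by linarith
    qed
    then have "energy xs vs (t + h) \<le> energy xs vs t - 2 * (\<epsilon> / 2) * (t + h - t)"
      using t0 that h by (intro energy_decrease[OF saddle]) auto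
    moreover have "energy xs vs t \<le> energy xs vs t0"
      using t0 that by (intro energy_antimono[OF saddle]) auto
    moreover have "I \<le> energy xs vs (t + h)" using t0 that h by (intro I) auto
    ultimately show False using t0(2) by simp
  qed
  then have "\<forall>t\<ge>t0. dist (gap xs vs (x t)) 0 < \<epsilon>"
    using gap_nonneg[OF saddle x_in_K] t0 by simp
  then show "\<forall>\<^sub>F t in at_top. dist (gap xs vs (x t)) 0 < \<epsilon>"
    unfolding eventually_at_top_linorder by blast
qed

section \<open>Limits of the residual and of the objective\<close>

lemma res_tendsto_0:
  assumes saddle: "saddle_point K f A b xs vs"
  shows "(res \<longlongrightarrow> 0) at_top"
proof -
  have "((\<lambda>t. (norm (res t))\<^sup>2) \<longlongrightarrow> 0) at_top"
  proof (rule tendsto_sandwich[OF _ _ tendsto_const gap_tendsto_0[OF saddle]])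
    show "\<forall>\<^sub>F t in at_top. (norm (res t))\<^sup>2 \<le> gap xs vs (x t)"
      using eventually_ge_at_top[of 0]
      by eventually_elim (auto simp: res_def intro: gap_ge_residual[OF saddle x_in_K])
  qed simp
  then show ?thesis
    using tendsto_real_sqrt[of "\<lambda>t. (norm (res t))\<^sup>2" 0] by (simp add: tendsto_norm_zero_iff)
qed

lemma f_tendsto:
  assumes saddle: "saddle_point K f A b xs vs"
  shows "((\<lambda>t. f (x t)) \<longlongrightarrow> f xs) at_top"
proof -
  have "((\<lambda>t. gap xs vs (x t) - vs \<bullet> res t - (norm (res t))\<^sup>2 + f xs) \<longlongrightarrow>
      0 - vs \<bullet> 0 - (norm (0 :: real^'m))\<^sup>2 + f xs) at_top"
    by (intro tendsto_intros gap_tendsto_0[OF saddle] res_tendsto_0[OF saddle])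
  then show ?thesis by (simp add: gap_def res_def)
qed

text \<open>
  The residual, which is the velocity of \<open>v\<close>, tends to \<open>0\<close>. So on windows of fixed length starting at
  times along which \<open>(x, v)\<close> converges to \<open>(xb, vb)\<close>, \<open>v\<close> is nearly \<open>vb\<close>; if \<open>y\<close> violated the saddle
  inequality, the squared distance from \<open>x\<close> to \<open>y\<close> would drop at a fixed rate throughout the window,
  contradicting boundedness of the trajectory when the window is long.
\<close>

lemma limit_point_saddle:
  assumes saddle: "saddle_point K f A b xs vs"
    and t: "filterlim t at_top sequentially" "\<And>k::nat. t k \<ge> 0"
    and lim: "(\<lambda>k. x (t k)) \<longlonglongrightarrow> xb" "(\<lambda>k. v (t k)) \<longlonglongrightarrow> vb"
  shows "saddle_point K f A b xb vb"
proof (rule saddle_pointI)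
  show "xb \<in> K"
    using closed_sequentially[OF closed_K _ lim(1)] x_in_K t(2) by blast
  have "(\<lambda>k. res (t k)) \<longlonglongrightarrow> A *v xb - b"
    unfolding res_def
    by (intro tendsto_intros bounded_linear.tendsto[OF matrix_vector_mul_bounded_linear] lim)
  moreover have "(\<lambda>k. res (t k)) \<longlonglongrightarrow> 0"
    using filterlim_compose[OF res_tendsto_0[OF saddle] t(1)] .
  ultimately show "A *v xb = b" using LIMSEQ_unique by fastforce
  have "isCont f xb" using continuous_f by (simp add: continuous_on_eq_continuous_at)
  then have "(\<lambda>k. f (x (t k))) \<longlonglongrightarrow> f xb" using isCont_tendsto_compose lim(1) by blast
  then have fxb: "f xb = f xs"
    using filterlim_compose[OF f_tendsto[OF saddle] t(1)] LIMSEQ_unique by blast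
  obtain R where R: "\<And>t. t \<ge> 0 \<Longrightarrow> norm (x t, v t) \<le> R"
    by (rule trajectory_bounded[OF saddle]) (rule that)
  fix y assume y: "y \<in> K"
  show "f xb \<le> f y + vb \<bullet> (A *v y - b)"
  proof (rule ccontr)
    assume neg: "\<not> f xb \<le> f y + vb \<bullet> (A *v y - b)"
    define \<eta> where "\<eta> = f xs - (f y + vb \<bullet> (A *v y - b))"
    have "\<eta> > 0" using neg by (simp add: \<eta>_def fxb)
    \<comment> \<open>A window this long makes the guaranteed drop \<open>\<eta> * T\<close> exceed
      the bound \<open>(R + norm y)\<^sup>2\<close> on the squared distance to
      \<open>y\<close>.\<close>
    define T where "T = ((R + norm y)\<^sup>2 + 1) / \<eta>"
    have "T > 0" unfolding T_def using \<open>\<eta> > 0\<close> by (intro divide_pos_pos add_nonneg_pos) auto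
    define \<psi> where "\<psi> s = f y - f (x s) + (v s + res s) \<bullet> (A *v y - A *v x s)" for s
    \<comment> \<open>Proving the limit for every selection of times \<open>s k\<close> from the
      windows replaces a uniform statement over each window.\<close>
    have \<psi>_lim: "(\<lambda>k. \<psi> (s k)) \<longlonglongrightarrow> - \<eta>" if s: "\<And>k. s k \<in> {t k..t k + T}" for s
    proof -
      have s_top: "filterlim s at_top sequentially"
        by (rule filterlim_at_top_mono[OF t(1)]) (use s in auto)
      have res_s: "(\<lambda>k. res (s k)) \<longlonglongrightarrow> 0"
        using filterlim_compose[OF res_tendsto_0[OF saddle] s_top] .
      have f_s: "(\<lambda>k. f (x (s k))) \<longlonglongrightarrow> f xs"
        using filterlim_compose[OF f_tendsto[OF saddle] s_top] .
      have "(\<lambda>k. v (s k) - v (t k)) \<longlonglongrightarrow> 0"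
      proof (rule tendstoI)
        fix e :: real assume "e > 0"
        then have "e / (2 * T) > 0" using \<open>T > 0\<close> by simp
        then have "\<forall>\<^sub>F r in at_top. norm (res r) < e / (2 * T)"
          using tendstoD[OF res_tendsto_0[OF saddle]] by (simp add: dist_norm)
        then obtain r0 where r0: "\<And>r. r \<ge> r0 \<Longrightarrow> norm (res r) < e / (2 * T)"
          unfolding eventually_at_top_linorder by blast
        have "\<forall>\<^sub>F k in sequentially. t k \<ge> r0"
          using t(1) unfolding filterlim_at_top by blast
        then show "\<forall>\<^sub>F k in sequentially. dist (v (s k) - v (t k)) 0 < e"
        proof eventually_elim
          case (elim k)
          have "norm (v (s k) - v (t k)) \<le> e / (2 * T) * (s k - t k)"
          proof (rule v_increment_le)
            show "norm (res r) \<le> e / (2 * T)" if "r \<in> {t k..s k}" for r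
              using r0[of r] that elim by simp
          qed (use t(2)[of k] s[of k] \<open>e / (2 * T) > 0\<close> in auto)
          also have "\<dots> \<le> e / (2 * T) * T"
            using s[of k] \<open>e / (2 * T) > 0\<close> by (intro mult_left_mono) auto
          also have "\<dots> < e" using \<open>T > 0\<close> \<open>e > 0\<close> by simp
          finally show ?case by simp
        qed
      qed
      then have v_s: "(\<lambda>k. v (s k)) \<longlonglongrightarrow> vb"
        using tendsto_add[OF _ lim(2)] by fastforce
      have "(\<lambda>k. f y - f (x (s k)) + (v (s k) + res (s k)) \<bullet> (A *v y - (b + res (s k)))) \<longlonglongrightarrow>
          f y - f xs + (vb + 0) \<bullet> (A *v y - (b + 0))"
        by (intro tendsto_intros f_s v_s res_s)
      then show ?thesis by (simp add: \<psi>_def \<eta>_def res_def diff_add_eq)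
    qed
    \<comment> \<open>The selection takes a time violating the bound whenever the window has one,
      with default \<open>t k\<close>. A single \<open>k\<close> for which
      \<open>\<psi> (s k)\<close> is below \<open>- (\<eta> / 2)\<close> then has no violation in
      its whole window.\<close>
    define s where "s k = (if \<exists>r\<in>{t k..t k + T}. - (\<eta> / 2) \<le> \<psi> r
        then SOME r. r \<in> {t k..t k + T} \<and> - (\<eta> / 2) \<le> \<psi> r else t k)" for k
    have s: "s k \<in> {t k..t k + T} \<and> ((\<exists>r\<in>{t k..t k + T}. - (\<eta> / 2) \<le> \<psi> r) \<longrightarrow> - (\<eta> / 2) \<le> \<psi> (s k))" for k
    proof (cases "\<exists>r\<in>{t k..t k + T}. - (\<eta> / 2) \<le> \<psi> r")
      case True
      then have "\<exists>r. r \<in> {t k..t k + T} \<and> - (\<eta> / 2) \<le> \<psi> r" by blast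
      from someI_ex[OF this] show ?thesis using True by (simp add: s_def)
    next
      case False
      then show ?thesis using \<open>T > 0\<close> by (simp add: s_def)
    qed
    have "\<forall>\<^sub>F k in sequentially. \<psi> (s k) < - (\<eta> / 2)"
      by (rule order_tendstoD(2)[OF \<psi>_lim]) (use s \<open>\<eta> > 0\<close> in auto)
    then obtain k where "\<psi> (s k) < - (\<eta> / 2)"
      using eventually_happens'[OF sequentially_bot] by blast
    then have \<psi>: "\<psi> r \<le> - (\<eta> / 2)" if "r \<in> {t k..t k + T}" for r
      using s[of k] that by force
    have "(norm (x (t k + T) - y))\<^sup>2 \<le> (norm (x (t k) - y))\<^sup>2 + 2 * - (\<eta> / 2) * (t k + T - t k)"
    proof (rule abs_continuous_on_dist_sq_le[OF ac_x_Icc[OF t(2)] _ negligible_N])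
      fix r assume r: "r \<in> {t k..t k + T} - N"
      have "xdot r \<bullet> (x r - y) \<le> \<psi> r"
        unfolding \<psi>_def using xdot_dot_le[of r y] y r t(2)[of k] by auto
      then show "\<exists>d. (x has_vector_derivative d) (at r within {t k..t k + T}) \<and> d \<bullet> (x r - y) \<le> - (\<eta> / 2)"
        using x_deriv_Icc[OF t(2) r] \<psi>[of r] r by force
    qed (use \<open>T > 0\<close> in simp)
    then have "(norm (x (t k + T) - y))\<^sup>2 \<le> (norm (x (t k) - y))\<^sup>2 - \<eta> * T" by simp
    then have "(norm (x (t k) - y))\<^sup>2 \<ge> \<eta> * T"
      using zero_le_power2[of "norm (x (t k + T) - y)"] by linarith
    moreover have "(norm (x (t k) - y))\<^sup>2 \<le> (R + norm y)\<^sup>2"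
    proof (rule power_mono)
      show "norm (x (t k) - y) \<le> R + norm y"
        using norm_triangle_ineq4[of "x (t k)" y] R[OF t(2)] norm_fst_le[of "x (t k)" "v (t k)"]
        by (meson add_mono_thms_linordered_semiring(3) order_trans)
    qed simp
    moreover have "\<eta> * T = (R + norm y)\<^sup>2 + 1" using \<open>\<eta> > 0\<close> by (simp add: T_def)
    ultimately show False by simp
  qed
qed

text \<open>Opial's argument: the distance to a saddle point that is a limit point is monotone and small infinitely often.\<close>

lemma converges_to_saddle_point:
  assumes saddle: "saddle_point K f A b xs vs"
  shows "\<exists>xb vb. saddle_point K f A b xb vb \<and> (x \<longlongrightarrow> xb) at_top \<and> (v \<longlongrightarrow> vb) at_top"
proof -
  obtain R where R: "\<And>t. t \<ge> 0 \<Longrightarrow> norm (x t, v t) \<le> R"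
    by (rule trajectory_bounded[OF saddle]) (rule that)
  then have "bounded (range (\<lambda>k::nat. (x (real k), v (real k))))"
    unfolding bounded_iff by (intro exI[of _ R]) auto
  then obtain p r where r: "strict_mono r" "((\<lambda>k. (x (real k), v (real k))) \<circ> r) \<longlonglongrightarrow> p"
    using bounded_imp_convergent_subsequence by blast
  obtain xb vb where p: "p = (xb, vb)" by force
  define t where "t k = real (r k)" for k
  have t_top: "filterlim t at_top sequentially"
    unfolding t_def
    by (rule filterlim_compose[OF filterlim_real_sequentially filterlim_subseq[OF r(1)]])
  have zlim: "(\<lambda>k. (x (t k), v (t k))) \<longlonglongrightarrow> (xb, vb)"
    using r(2) by (simp add: p o_def t_def)
  have sb: "saddle_point K f A b xb vb"
    using tendsto_fst[OF zlim] tendsto_snd[OF zlim]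
    by (intro limit_point_saddle[OF saddle t_top]) (auto simp: t_def)
  have "((\<lambda>t. (x t, v t)) \<longlongrightarrow> (xb, vb)) at_top"
  proof (rule tendstoI)
    fix e :: real assume "e > 0"
    obtain k where k: "dist (x (t k), v (t k)) (xb, vb) < e"
      using eventually_happens'[OF sequentially_bot tendstoD[OF zlim \<open>e > 0\<close>]] by blast
    have "dist (x s, v s) (xb, vb) < e" if "s \<ge> t k" for s
    proof -
      have "norm ((x s, v s) - (xb, vb)) \<le> norm ((x (t k), v (t k)) - (xb, vb))"
        using energy_antimono[OF sb _ that] unfolding energy_def
        by (intro power2_le_imp_le[OF _ norm_ge_zero]) (simp add: t_def)
      then show ?thesis using k by (simp add: dist_norm)
    qed
    then show "\<forall>\<^sub>F s in at_top. dist (x s, v s) (xb, vb) < e"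
      unfolding eventually_at_top_linorder by blast
  qed
  then show ?thesis using sb tendsto_fst[of "\<lambda>t. (x t, v t)"] tendsto_snd[of "\<lambda>t. (x t, v t)"]
    by fastforce
qed

end

theorem proposition3:
  fixes K :: "(real^'n) set"
    and A :: "real^'n^'m"
    and b :: "real^'m"
    and f :: "real^'n \<Rightarrow> real"
    and gradf :: "real^'n \<Rightarrow> real^'n"
    and x :: "real \<Rightarrow> real^'n"
    and v :: "real \<Rightarrow> real^'m"
    and x0 :: "real^'n"
    and v0 :: "real^'m"
  assumes "closed K" and "convex K"
    and "convex_on UNIV f"
    and "\<And>y. GDERIV f y :> gradf y"
    and "\<And>y. \<exists>r>0. \<exists>L. L-lipschitz_on (cball y r) gradf"
    and "slater_condition K A b"
    and "\<exists>xs. optimal_solution K f A b xs"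
    and "x0 \<in> K"
    and "x 0 = x0" and "v 0 = v0"
    and "\<And>T. T > 0 \<Longrightarrow> abs_continuous_on {0..T} x"
    and "\<And>T. T > 0 \<Longrightarrow> abs_continuous_on {0..T} v"
    and "\<And>t. t \<ge> 0 \<Longrightarrow> x t \<in> K"
    and "AE t in lebesgue_on {0..}.
           (x has_vector_derivative
              proj_operator K (x t)
                (- gradf (x t) - transpose A *v v t - transpose A *v (A *v x t - b)))
             (at t within {0..})"
    and "AE t in lebesgue_on {0..}.
           (v has_vector_derivative (A *v x t - b)) (at t within {0..})"
  shows "\<exists>xs vs. saddle_point K f A b xs vs \<and>
           (x \<longlongrightarrow> xs) at_top \<and> (v \<longlongrightarrow> vs) at_top"
proof -
  let ?P = "\<lambda>t. (x has_vector_derivative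
              proj_operator K (x t)
                (- gradf (x t) - transpose A *v v t - transpose A *v (A *v x t - b)))
             (at t within {0..}) \<and> (v has_vector_derivative (A *v x t - b)) (at t within {0..})"
  \<comment> \<open>The two exceptional sets are merged and the restricted measure is removed, which
    yields the single null set \<open>N\<close> of the locale.\<close>
  have "AE t in lebesgue_on {0..}. ?P t" using assms(14,15) by eventually_elim (rule conjI)
  moreover have "{0::real..} \<inter> space lebesgue \<in> sets lebesgue" by simp
  ultimately have "AE t in lebesgue. t \<in> {0..} \<longrightarrow> ?P t"
    by (simp only: AE_restrict_space_iff)
  then obtain N where N: "N \<in> null_sets lebesgue" "{t \<in> space lebesgue. \<not> (t \<in> {0..} \<longrightarrow> ?P t)} \<subseteq> N"
    unfolding eventually_ae_filter by blast
  have P: "?P t" if "t \<ge> 0" "t \<notin> N" for t using N(2) that by force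
  have "continuous_on UNIV gradf"
  proof (intro continuous_at_imp_continuous_on ballI)
    fix y
    obtain r L where r: "r > 0" "L-lipschitz_on (cball y r) gradf" using assms(5) by blast
    then have "continuous_on (ball y r) gradf"
      by (meson ball_subset_cball continuous_on_subset lipschitz_on_continuous_on)
    then show "isCont gradf y"
      using r(1) continuous_on_eq_continuous_at[OF open_ball] centre_in_ball by blast
  qed
  then interpret primal_dual_flow K f gradf A b x v N
    using assms(1-4,11-13) N(1) P by unfold_locales (auto simp: negligible_iff_null_sets)
  obtain xs where "optimal_solution K f A b xs" using assms(7) by blast
  then obtain vs where "saddle_point K f A b xs vs"
    using slater_imp_saddle_point[OF assms(2,3,6)] by blast
  then show ?thesis by (rule converges_to_saddle_point)
qed

end
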